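(* Let $d \ge 2$ and $k \geq \max\{2, (d-1)(d-2)\}$ be integers. Then for any compact, star-shaped set $S \subset \mathbb{R}^d$ we have $$\operatorname{vol}\left( \frac{1}{k+1} S[k+1] \right) \geq \operatorname{vol}\left( \frac{1}{k} S[k] \right),$$ with equality if and only if $\dim(S) < d$ or $\frac{1}{k} S[k] = \operatorname{conv}(S)$.
   Context: For $A \subset \mathbb{R}^d$ and an integer $m\ge 1$, $A[m] = \{a_1+\cdots+a_m : a_1,\ldots,a_m \in A\}$ is the Minkowski sum of $m$ copies of $A$, and $tA=\{ta: a\in A\}$ for $t \in \mathbb{R}$. $\operatorname{vol}$ denotes Lebesgue measure on $\mathbb{R}^d$, $\operatorname{conv}$ denotes convex hull, and $\dim(A)$ is the dimension of the smallest affine subspace containing $A$. For $p,q\in\mathbb{R}^d$, $[p,q]$ is the closed segment with endpoints $p,q$. A nonempty set $S \subset \mathbb{R}^d$ is star-shaped with respect to a point $p$ if $[p,q] \subseteq S$ for every $q \in S$; $S$ is star-shaped if it is star-shaped with respect to some point $p$. *)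

theory Defs
  imports "HOL-Analysis.Analysis"
begin

definition iterated_sumset :: "'a::comm_monoid_add set \<Rightarrow> nat \<Rightarrow> 'a set"
  where "iterated_sumset A m = {(\<Sum>i<m. a i) | a. \<forall>i<m. a i \<in> A}"

definition sumset_average :: "'a::real_vector set \<Rightarrow> nat \<Rightarrow> 'a set"
  where "sumset_average A m = (\<lambda>x. (1 / real m) *\<^sub>R x) ` iterated_sumset A m"

end

theory Submission
  imports Defs
begin

text \<open>Put the centre of the star at the origin, let \<open>d\<close> be the dimension, and write \<open>C\<close> for the convex hull
  and \<open>G\<^sub>m = m C - S[m]\<close>. It suffices to show
  \<open>vol G\<^sub>k\<^sub>+\<^sub>1 \<le> R vol G\<^sub>k\<close> with \<open>R = 1 + (d - 1) / (k + 2 - d)\<close>, because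
  \<open>k \<ge> (d - 1) (d - 2)\<close> gives \<open>R < (1 + 1 / k)\<^sup>d\<close>.

  Suppose first that \<open>C\<close> is a polytope all of whose facets are simplices with vertices in \<open>S\<close>. In the cone over
  a facet with vertices \<open>b\<^sub>1, \<dots>, b\<^sub>d\<close>, let \<open>x\<close> have coordinates \<open>a\<^sub>i\<close> with integer parts \<open>n\<^sub>i\<close> and
  put \<open>s = \<Sum>n\<^sub>i\<close>. Since \<open>S\<close> is star-shaped, \<open>s + d \<le> m\<close> forces \<open>x \<in> S[m]\<close>; hence
  \<open>s \<ge> k + 2 - d\<close> on \<open>G\<^sub>k\<^sub>+\<^sub>1\<close>. Moreover \<open>x \<in> G\<^sub>k\<^sub>+\<^sub>1\<close> and \<open>n\<^sub>i \<ge> 1\<close> imply \<open>x - b\<^sub>i \<in> G\<^sub>k\<close>. Sending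
  the fraction \<open>n\<^sub>i / s\<close> of the mass at \<open>x\<close> to \<open>x - b\<^sub>i\<close>, a point of \<open>G\<^sub>k\<close> with integer parts
  summing to \<open>s\<close> receives at most \<open>(s + d) / (s + 1) \<le> R\<close> (a weighted local LYM inequality).

  In general \<open>S\<close> is enlarged slightly to a star of this kind and outer regularity of Lebesgue measure is
  used. As \<open>R < (1 + 1 / k)\<^sup>d\<close> is strict, equality of the volumes forces \<open>vol G\<^sub>k = 0\<close>.\<close>

subsection \<open>Iterated sumsets\<close>

lemma iterated_sumset_0 [simp]: "iterated_sumset A 0 = {0}"
  by (auto simp: iterated_sumset_def)

lemma iterated_sumset_Suc:
  "iterated_sumset A (Suc m) = {x + y | x y. x \<in> iterated_sumset A m \<and> y \<in> A}"
proof (intro set_eqI iffI)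
  fix z assume "z \<in> iterated_sumset A (Suc m)"
  then obtain a where "\<forall>i<Suc m. a i \<in> A" "z = (\<Sum>i<m. a i) + a m"
    by (auto simp: iterated_sumset_def)
  then show "z \<in> {x + y | x y. x \<in> iterated_sumset A m \<and> y \<in> A}"
    by (force simp: iterated_sumset_def)
next
  fix z assume "z \<in> {x + y | x y. x \<in> iterated_sumset A m \<and> y \<in> A}"
  then obtain a y where a: "\<forall>i<m. a i \<in> A" "z = (\<Sum>i<m. a i) + y" "y \<in> A"
    by (auto simp: iterated_sumset_def)
  have "(\<Sum>i<m. (a(m := y)) i) = (\<Sum>i<m. a i)"
    by (rule sum.cong) auto
  with a show "z \<in> iterated_sumset A (Suc m)"
    unfolding iterated_sumset_def
    by (intro CollectI exI[of _ "a(m := y)"]) (auto simp: less_Suc_eq)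
qed

lemma iterated_sumset_add:
  "x \<in> iterated_sumset A m \<Longrightarrow> y \<in> iterated_sumset A n \<Longrightarrow> x + y \<in> iterated_sumset A (m + n)"
proof (induction n arbitrary: y)
  case (Suc n)
  then obtain u v where "y = u + v" "u \<in> iterated_sumset A n" "v \<in> A"
    by (auto simp: iterated_sumset_Suc)
  with Suc show ?case
    by (auto simp: iterated_sumset_Suc add.assoc[symmetric])
qed simp

lemma iterated_sumset_mono: "A \<subseteq> B \<Longrightarrow> iterated_sumset A m \<subseteq> iterated_sumset B m"
  unfolding iterated_sumset_def by blast

lemma iterated_sumset_mono_index:
  assumes "0 \<in> A" "m \<le> n"
  shows "iterated_sumset A m \<subseteq> iterated_sumset A n"
  using assms(2)
proof (induction n rule: dec_induct)
  case (step n)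
  have "iterated_sumset A n \<subseteq> iterated_sumset A (Suc n)"
    using assms(1) by (force simp: iterated_sumset_Suc)
  with step show ?case by blast
qed simp

lemma iterated_sumset_sum:
  assumes "finite I" "\<And>i. i \<in> I \<Longrightarrow> f i \<in> iterated_sumset A (m i)"
  shows "sum f I \<in> iterated_sumset A (sum m I)"
  using assms by (induction I rule: finite_induct) (auto intro: iterated_sumset_add)

lemma iterated_sumset_scaleR:
  fixes x :: "'a::real_vector"
  assumes "x \<in> A"
  shows "real m *\<^sub>R x \<in> iterated_sumset A m"
proof (induction m)
  case (Suc m)
  have "real (Suc m) *\<^sub>R x = real m *\<^sub>R x + x"
    by (simp add: algebra_simps)
  with Suc assms show ?case
    unfolding iterated_sumset_Suc by blast
qed simp

lemma compact_iterated_sumset: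
  fixes A :: "'a::real_normed_vector set"
  assumes "compact A"
  shows "compact (iterated_sumset A m)"
  using compact_sums[OF _ assms] by (induction m) (auto simp: iterated_sumset_Suc)

lemma sumset_average_subset_hull:
  assumes "m > 0"
  shows "sumset_average A m \<subseteq> convex hull A"
proof
  fix x assume "x \<in> sumset_average A m"
  then obtain a where a: "\<forall>i<m. a i \<in> A" and "x = (\<Sum>i<m. (1 / real m) *\<^sub>R a i)"
    by (auto simp: sumset_average_def iterated_sumset_def scaleR_sum_right)
  moreover have "(\<Sum>i<m. (1 / real m) *\<^sub>R a i) \<in> convex hull A"
    using a assms by (intro convex_sum) (auto intro: hull_inc)
  ultimately show "x \<in> convex hull A" by simp
qed

lemma compact_sumset_average:
  fixes A :: "'a::real_normed_vector set"
  assumes "compact A"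
  shows "compact (sumset_average A m)"
  unfolding sumset_average_def by (intro compact_scaling compact_iterated_sumset assms)

lemma scaleR_sumset_average:
  "m > 0 \<Longrightarrow> (\<lambda>x. real m *\<^sub>R x) ` sumset_average A m = iterated_sumset A m"
  by (simp add: sumset_average_def image_image)

lemma iterated_sumset_translation:
  fixes a :: "'a::real_vector"
  shows "iterated_sumset ((+) a ` A) m = (+) (real m *\<^sub>R a) ` iterated_sumset A m"
proof (induction m)
  case (Suc m)
  show ?case
  proof (intro set_eqI iffI)
    fix z assume "z \<in> iterated_sumset ((+) a ` A) (Suc m)"
    then obtain x y where "x \<in> iterated_sumset A m" "y \<in> A" "z = (real m *\<^sub>R a + x) + (a + y)"
      by (auto simp: iterated_sumset_Suc Suc)
    moreover from this have "z = real (Suc m) *\<^sub>R a + (x + y)"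
      by (simp add: algebra_simps)
    ultimately show "z \<in> (+) (real (Suc m) *\<^sub>R a) ` iterated_sumset A (Suc m)"
      unfolding iterated_sumset_Suc by blast
  next
    fix z assume "z \<in> (+) (real (Suc m) *\<^sub>R a) ` iterated_sumset A (Suc m)"
    then obtain x y where "x \<in> iterated_sumset A m" "y \<in> A" "z = (real m *\<^sub>R a + x) + (a + y)"
      by (auto simp: iterated_sumset_Suc algebra_simps)
    then show "z \<in> iterated_sumset ((+) a ` A) (Suc m)"
      unfolding iterated_sumset_Suc Suc by blast
  qed
qed simp

lemma sumset_average_translation:
  fixes a :: "'a::real_vector"
  assumes "m > 0"
  shows "sumset_average ((+) a ` A) m = (+) a ` sumset_average A m"
  using assms by (simp add: sumset_average_def iterated_sumset_translation image_image scaleR_add_right)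

text \<open>This bounds the total weight a point receives in the redistribution: \<open>n\<close>
  holds the integer parts of its coordinates, \<open>D\<close> is the dimension and \<open>q\<close>
  stands for \<open>k + 2 - d\<close>. With \<open>s = sum n B\<close> the total is at most
  \<open>(s + D) / (s + 1)\<close>, which decreases in \<open>s\<close>.\<close>

lemma sum_incremented_fractions_le:
  fixes n :: "'a \<Rightarrow> real"
  assumes "finite B" "\<And>b. b \<in> B \<Longrightarrow> 0 \<le> n b" "real (card B) \<le> D" "0 < q" "q \<le> sum n B + 1" "D \<ge> 1"
  shows "(\<Sum>b\<in>B. (n b + 1) / (sum n B + 1)) \<le> 1 + (D - 1) / q"
proof -
  have "(\<Sum>b\<in>B. (n b + 1) / (sum n B + 1)) = (sum n B + real (card B)) / (sum n B + 1)"
    by (simp add: sum_divide_distrib[symmetric] sum.distrib)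
  also have "\<dots> \<le> (sum n B + D) / (sum n B + 1)"
    using assms by (intro divide_right_mono) auto
  also have "\<dots> = 1 + (D - 1) / (sum n B + 1)"
    using assms by (simp add: field_simps)
  also have "\<dots> \<le> 1 + (D - 1) / q"
    using assms by (intro add_left_mono divide_left_mono mult_pos_pos) auto
  finally show ?thesis .
qed

subsection \<open>The gap inside a simplicial cone\<close>

text \<open>For a basis \<open>B\<close> the first set is \<open>m\<close> times the simplex spanned
  by 0 and \<open>B\<close>, so this is the share of the gap of order \<open>m\<close> in the cone
  over one facet. Coordinates rather than hulls are used because integer parts of coordinates steer
  the redistribution.\<close>

definition cone_gap :: "'a::real_vector set \<Rightarrow> 'a set \<Rightarrow> nat \<Rightarrow> 'a set"
  where "cone_gap S B m =
    {x. (\<forall>b\<in>B. 0 \<le> representation B x b) \<and> (\<Sum>b\<in>B. representation B x b) \<le> real m}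
      - iterated_sumset S m"

lemma borel_measurable_representation:
  fixes B :: "'a::euclidean_space set"
  assumes "independent B" "span B = UNIV"
  shows "(\<lambda>x. representation B x b) \<in> borel_measurable borel"
proof -
  have "linear (\<lambda>x. representation B x b)"
    using assms by (intro linearI) (auto simp: representation_add representation_scale)
  then show ?thesis
    by (intro borel_measurable_continuous_onI linear_continuous_on) (simp add: linear_conv_bounded_linear)
qed

lemma sets_cone_gap:
  fixes B :: "'a::euclidean_space set"
  assumes "independent B" "span B = UNIV" "compact S"
  shows "cone_gap S B m \<in> sets borel"
proof -
  note [measurable] = borel_measurable_representation[OF assms(1,2)]
  have "finite B" using assms(1) by (rule independent_imp_finite)
  then have [measurable]: "{x. (\<forall>b\<in>B. 0 \<le> representation B x b) \<and> (\<Sum>b\<in>B. representation B x b) \<le> real m} \<in> sets borel"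
    by measurable
  have [measurable]: "iterated_sumset S m \<in> sets borel"
    using assms(3) by (intro borel_closed compact_imp_closed compact_iterated_sumset)
  show ?thesis
    unfolding cone_gap_def by measurable
qed

text \<open>Each term \<open>a b *\<^sub>R b\<close> splits into \<open>floor (a b)\<close> copies
  of \<open>b\<close> and one shortened copy, which is in \<open>S\<close> by the star property.
  Thus \<open>x\<close> is a sum of (sum of floors) + \<open>card B\<close> points of
  \<open>S\<close>; if this number were at most \<open>m\<close>, padding with 0 would put
  \<open>x\<close> into the sumset of order \<open>m\<close>.\<close>

lemma floor_sum_ge_if_in_cone_gap:
  fixes B :: "'a::real_vector set"
  assumes B: "independent B" "span B = UNIV" "finite B" "B \<subseteq> S"
    and star: "\<And>x t. x \<in> S \<Longrightarrow> 0 \<le> t \<Longrightarrow> t \<le> 1 \<Longrightarrow> t *\<^sub>R x \<in> S"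
    and "0 \<in> S" "x \<in> cone_gap S B m"
  shows "int m + 1 \<le> (\<Sum>b\<in>B. \<lfloor>representation B x b\<rfloor>) + int (card B)"
proof (rule ccontr)
  assume less: "\<not> int m + 1 \<le> (\<Sum>b\<in>B. \<lfloor>representation B x b\<rfloor>) + int (card B)"
  let ?a = "representation B x"
  have nonneg: "0 \<le> ?a b" if "b \<in> B" for b
    using assms that by (auto simp: cone_gap_def)
  have "?a b *\<^sub>R b \<in> iterated_sumset S (nat \<lfloor>?a b\<rfloor> + 1)" if b: "b \<in> B" for b
  proof -
    have "frac (?a b) *\<^sub>R b \<in> S"
      using B(4) b by (intro star) (auto simp: frac_lt_1 less_imp_le)
    then have "frac (?a b) *\<^sub>R b \<in> iterated_sumset S 1"
      using iterated_sumset_scaleR[of "frac (?a b) *\<^sub>R b" S 1] by simp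
    moreover have "real (nat \<lfloor>?a b\<rfloor>) *\<^sub>R b \<in> iterated_sumset S (nat \<lfloor>?a b\<rfloor>)"
      using B(4) b by (intro iterated_sumset_scaleR) auto
    ultimately have "real (nat \<lfloor>?a b\<rfloor>) *\<^sub>R b + frac (?a b) *\<^sub>R b \<in> iterated_sumset S (nat \<lfloor>?a b\<rfloor> + 1)"
      by (rule iterated_sumset_add[rotated])
    moreover have "real (nat \<lfloor>?a b\<rfloor>) *\<^sub>R b + frac (?a b) *\<^sub>R b = ?a b *\<^sub>R b"
      using nonneg[OF b] by (simp add: frac_def scaleR_left_distrib[symmetric])
    ultimately show ?thesis by simp
  qed
  then have "(\<Sum>b\<in>B. ?a b *\<^sub>R b) \<in> iterated_sumset S (\<Sum>b\<in>B. nat \<lfloor>?a b\<rfloor> + 1)"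
    using B(3) by (intro iterated_sumset_sum)
  moreover have "(\<Sum>b\<in>B. ?a b *\<^sub>R b) = x"
    using B by (intro sum_representation_eq) auto
  moreover have "(\<Sum>b\<in>B. nat \<lfloor>?a b\<rfloor> + 1) \<le> m"
  proof -
    have "int (\<Sum>b\<in>B. nat \<lfloor>?a b\<rfloor> + 1) = (\<Sum>b\<in>B. \<lfloor>?a b\<rfloor>) + int (card B)"
      using nonneg by (simp add: sum.distrib cong: sum.cong)
    with less show ?thesis by linarith
  qed
  ultimately have "x \<in> iterated_sumset S m"
    using iterated_sumset_mono_index[OF \<open>0 \<in> S\<close>] by auto
  with assms(7) show False by (simp add: cone_gap_def)
qed

lemma representation_add_basis:
  fixes B :: "'a::real_vector set"
  assumes "independent B" "span B = UNIV" "b \<in> B"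
  shows "representation B (x + b) c = representation B x c + (if c = b then 1 else 0)"
  using assms by (simp add: representation_add representation_basis)

text \<open>Removing \<open>b\<close> lowers just one coordinate by 1, and that coordinate was at
  least 1. A decomposition of \<open>y\<close> into \<open>k\<close> points of \<open>S\<close>
  would extend by \<open>b\<close> to one of \<open>y + b\<close>.\<close>

lemma cone_gap_shift:
  fixes B :: "'a::real_vector set"
  assumes B: "independent B" "span B = UNIV" "finite B" "b \<in> B" "b \<in> S"
    and "y + b \<in> cone_gap S B (Suc k)" "1 \<le> representation B (y + b) b"
  shows "y \<in> cone_gap S B k"
proof -
  have "y + b \<in> iterated_sumset S (Suc k)" if "y \<in> iterated_sumset S k"
    using that B(5) unfolding iterated_sumset_Suc by blast
  moreover have "(\<Sum>c\<in>B. representation B (y + b) c) = (\<Sum>c\<in>B. representation B y c) + 1"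
    using B by (simp add: representation_add_basis sum.distrib sum.delta')
  moreover have "0 \<le> representation B y c" if "c \<in> B" for c
    using assms that by (cases "c = b") (auto simp: cone_gap_def representation_add_basis)
  ultimately show ?thesis
    using assms by (auto simp: cone_gap_def)
qed

text \<open>Distribute the mass of each \<open>x\<close> in the gap of order \<open>k + 1\<close> over the points \<open>x - b\<close> of the gap of
  order \<open>k\<close>, with weights proportional to the integer parts of the coordinates of \<open>x\<close>; these
  are translations, so only the total weight received at each point matters.\<close>

lemma emeasure_cone_gap_Suc_le:
  fixes B :: "'a::euclidean_space set"
  assumes ind: "independent B" and card: "card B = DIM('a)" and BS: "B \<subseteq> S"
    and star: "\<And>x t. x \<in> S \<Longrightarrow> 0 \<le> t \<Longrightarrow> t \<le> 1 \<Longrightarrow> t *\<^sub>R x \<in> S"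
    and S: "0 \<in> S" "compact S" and k: "DIM('a) \<le> k + 1"
  shows "emeasure lborel (cone_gap S B (Suc k))
    \<le> ennreal (1 + (real DIM('a) - 1) / (real k + 2 - real DIM('a))) * emeasure lborel (cone_gap S B k)"
proof -
  let ?R = "1 + (real DIM('a) - 1) / (real k + 2 - real DIM('a))"
  have span: "span B = UNIV"
    using card_ge_dim_independent[of B UNIV] ind card by auto
  have fin: "finite B" using ind by (rule independent_imp_finite)
  note [measurable] = borel_measurable_representation[OF ind span] sets_cone_gap[OF ind span S(2)]
  define n where "n x b = real_of_int \<lfloor>representation B x b\<rfloor>" for x b
  have [measurable]: "(\<lambda>x. n x b) \<in> borel_measurable borel" for b
    unfolding n_def by measurable
  \<comment> \<open>The share of the unit mass at \<open>x\<close> that is sent to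
    \<open>x - b\<close>. On the gap the shares add up to 1, since \<open>n_sum\<close> makes the
    denominator positive.\<close>
  define f where "f b x = ennreal (n x b / sum (n x) B) * indicator (cone_gap S B (Suc k)) x" for b x
  have [measurable]: "f b \<in> borel_measurable borel" for b
    unfolding f_def using fin by measurable
  have n_nonneg: "0 \<le> n x b" if "x \<in> cone_gap S B m" "b \<in> B" for x b m
    using that by (simp add: n_def cone_gap_def)
  have n_sum: "real k + 2 - real DIM('a) \<le> sum (n x) B" if "x \<in> cone_gap S B (Suc k)" for x
  proof -
    have "real_of_int (int (Suc k) + 1) \<le> real_of_int ((\<Sum>b\<in>B. \<lfloor>representation B x b\<rfloor>) + int (card B))"
      using floor_sum_ge_if_in_cone_gap[OF ind span fin BS star S(1) that] by (subst of_int_le_iff)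
    then show ?thesis by (simp add: n_def card)
  qed
  have n_shift: "n (y + b) c = n y c + (if c = b then 1 else 0)" if "b \<in> B" for y b c
    using representation_add_basis[OF ind span that, of y c] by (simp add: n_def)
  have n_shift_self: "n (y + b) b = n y b + 1" if "b \<in> B" for y b
    using n_shift[OF that] by simp
  have sum_n_shift: "sum (n (y + b)) B = sum (n y) B + 1" if "b \<in> B" for y b
    using that fin by (simp add: n_shift sum.distrib sum.delta')

  have "emeasure lborel (cone_gap S B (Suc k)) = (\<integral>\<^sup>+x. indicator (cone_gap S B (Suc k)) x \<partial>lborel)"
    by simp
  also have "\<dots> = (\<integral>\<^sup>+x. (\<Sum>b\<in>B. f b x) \<partial>lborel)"
  proof (rule nn_integral_cong)
    fix x
    show "indicator (cone_gap S B (Suc k)) x = (\<Sum>b\<in>B. f b x)"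
    proof (cases "x \<in> cone_gap S B (Suc k)")
      case True
      have "0 < sum (n x) B" using n_sum[OF True] k by linarith
      moreover have "(\<Sum>b\<in>B. f b x) = ennreal (\<Sum>b\<in>B. n x b / sum (n x) B)"
        using True n_nonneg[OF True] by (simp add: f_def sum_ennreal sum_nonneg)
      ultimately show ?thesis
        using True by (simp add: sum_divide_distrib[symmetric])
    qed (simp add: f_def)
  qed
  also have "\<dots> = (\<Sum>b\<in>B. \<integral>\<^sup>+x. f b x \<partial>lborel)"
    by (rule nn_integral_sum) simp
  \<comment> \<open>Translation invariance switches from the sender \<open>x\<close> to the receiver
    \<open>y = x - b\<close>.\<close>
  also have "\<dots> = (\<Sum>b\<in>B. \<integral>\<^sup>+y. f b (y + b) \<partial>lborel)"
  proof (rule sum.cong[OF refl])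
    fix b
    have "(\<integral>\<^sup>+x. f b x \<partial>lborel) = (\<integral>\<^sup>+x. f b x \<partial>(distr lborel borel ((+) b)))"
      by (simp add: lborel_distr_plus)
    also have "\<dots> = (\<integral>\<^sup>+y. f b (b + y) \<partial>lborel)"
      by (rule nn_integral_distr) simp_all
    finally show "(\<integral>\<^sup>+x. f b x \<partial>lborel) = (\<integral>\<^sup>+y. f b (y + b) \<partial>lborel)"
      by (simp add: add.commute)
  qed
  also have "\<dots> = (\<integral>\<^sup>+y. (\<Sum>b\<in>B. f b (y + b)) \<partial>lborel)"
    by (rule nn_integral_sum[symmetric]) simp
  also have "\<dots> \<le> (\<integral>\<^sup>+y. ennreal ?R * indicator (cone_gap S B k) y \<partial>lborel)"
  proof (rule nn_integral_mono)
    fix y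
    \<comment> \<open>Nothing is sent outside the gap of order \<open>k\<close>: by
      \<open>cone_gap_shift\<close> a sender \<open>y + b\<close> would have integer part 0 at
      \<open>b\<close>.\<close>
    have f_eq_0: "f b (y + b) = 0" if "b \<in> B" "y \<notin> cone_gap S B k" for b
    proof (cases "y + b \<in> cone_gap S B (Suc k)")
      case True
      then have "\<not> 1 \<le> representation B (y + b) b"
        using that cone_gap_shift[OF ind span fin that(1) _ True] BS by blast
      then have "n (y + b) b \<le> 0" by (simp add: n_def floor_le_zero)
      with n_nonneg[OF True that(1)] have "n (y + b) b = 0" by simp
      then show ?thesis by (simp add: f_def)
    qed (simp add: f_def)
    show "(\<Sum>b\<in>B. f b (y + b)) \<le> ennreal ?R * indicator (cone_gap S B k) y"
    \<comment> \<open>If only the second condition fails, the integer parts of each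
      \<open>y + b\<close> sum to less than \<open>k + 2 - d\<close>, so by \<open>n_sum\<close> no
      sender exists and \<open>y\<close> receives nothing.\<close>
    proof (cases "y \<in> cone_gap S B k \<and> real k + 2 - real DIM('a) \<le> sum (n y) B + 1")
      case True
      then have nonneg: "0 \<le> n y b" if "b \<in> B" for b using that n_nonneg by blast
      then have "0 \<le> sum (n y) B" by (simp add: sum_nonneg)
      have "(\<Sum>b\<in>B. f b (y + b)) \<le> (\<Sum>b\<in>B. ennreal ((n y b + 1) / (sum (n y) B + 1)))"
        by (intro sum_mono) (auto simp: f_def n_shift_self sum_n_shift split: split_indicator)
      also have "\<dots> = ennreal (\<Sum>b\<in>B. (n y b + 1) / (sum (n y) B + 1))"
        using nonneg \<open>0 \<le> sum (n y) B\<close> by (intro sum_ennreal) simp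
      also have "\<dots> \<le> ennreal ?R"
        using fin nonneg k True by (intro ennreal_leI sum_incremented_fractions_le) (auto simp: card DIM_positive Suc_leI)
      finally show ?thesis using True by simp
    next
      case False
      have "f b (y + b) = 0" if "b \<in> B" for b
      proof (cases "y \<in> cone_gap S B k")
        case True
        with False that n_sum[of "y + b"] have "y + b \<notin> cone_gap S B (Suc k)"
          by (auto simp: sum_n_shift)
        then show ?thesis by (simp add: f_def)
      qed (use f_eq_0 that in blast)
      then show ?thesis by simp
    qed
  qed
  also have "\<dots> = ennreal ?R * emeasure lborel (cone_gap S B k)"
    by (simp add: nn_integral_cmult)
  finally show ?thesis .
qed

subsection \<open>Simplicial polytopes\<close>

lemma representation_eq_coeffs:
  fixes B :: "'a::real_vector set"
  assumes "independent B" "finite B" "b \<in> B"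
  shows "representation B (\<Sum>b\<in>B. c b *\<^sub>R b) b = c b"
proof -
  let ?x = "\<Sum>b\<in>B. c b *\<^sub>R b"
  have "?x \<in> span B" by (intro span_sum span_scale span_base)
  then have "(\<Sum>b\<in>B. representation B ?x b *\<^sub>R b) = ?x"
    using assms by (intro sum_representation_eq) auto
  then have "(\<Sum>b\<in>B. (representation B ?x b - c b) *\<^sub>R b) = 0"
    by (simp add: scaleR_left_diff_distrib sum_subtractf)
  then show ?thesis
    using independentD[OF assms(1,2) order_refl, of "\<lambda>b. representation B ?x b - c b"] assms(3) by simp
qed

text \<open>Dividing the coefficients by their sum gives a point of \<open>C\<close>; moving it
  towards 0 by the factor \<open>sum c B / r\<close> absorbs the missing weight. A vanishing sum is
  treated apart because it cannot be divided by.\<close>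

lemma sum_scaleR_in_scaled_convex:
  fixes C :: "'a::real_vector set"
  assumes "convex C" "0 \<in> C" "finite B" "B \<subseteq> C" "\<And>b. b \<in> B \<Longrightarrow> 0 \<le> c b" "sum c B \<le> r"
  shows "(\<Sum>b\<in>B. c b *\<^sub>R b) \<in> (\<lambda>x. r *\<^sub>R x) ` C"
proof (cases "sum c B = 0")
  case True
  then have "\<forall>b\<in>B. c b = 0" using assms by (simp add: sum_nonneg_eq_0_iff)
  then show ?thesis using assms(2) by (auto intro: image_eqI[of _ _ 0])
next
  case False
  let ?s = "sum c B"
  have "0 < ?s" using False assms by (simp add: order_less_le sum_nonneg)
  define y where "y = (\<Sum>b\<in>B. (c b / ?s) *\<^sub>R b)"
  have "y \<in> C"
    unfolding y_def using assms \<open>0 < ?s\<close>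
    by (intro convex_sum) (auto simp: sum_divide_distrib[symmetric])
  then have "(1 - ?s / r) *\<^sub>R 0 + (?s / r) *\<^sub>R y \<in> C"
    using assms \<open>0 < ?s\<close> by (intro convexD) auto
  moreover have "(\<Sum>b\<in>B. c b *\<^sub>R b) = r *\<^sub>R ((?s / r) *\<^sub>R y)"
    using \<open>0 < ?s\<close> assms(6) by (simp add: y_def scaleR_sum_right)
  ultimately show ?thesis by (metis add_0 image_eqI scaleR_zero_right)
qed

text \<open>The ray through \<open>x\<close> leaves the hull at a point with a supporting
  hyperplane, and only vertices on that hyperplane carry weight there. Genericity makes these
  vertices independent, hence at most \<open>d\<close> many; the condition on \<open>x\<close>
  excludes fewer than \<open>d\<close>. So \<open>x\<close> lies in the cone over a simplicial
  facet.\<close>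

lemma ray_in_facet_cone:
  fixes V :: "'a::euclidean_space set"
  assumes V: "finite V" "0 \<in> interior (convex hull V)"
    and generic: "\<And>u. independent {v \<in> V. u \<bullet> v = 1}"
    and x: "\<And>D. D \<subseteq> V \<Longrightarrow> card D < DIM('a) \<Longrightarrow> x \<notin> span D"
  obtains u c where "\<forall>v\<in>V. u \<bullet> v \<le> 1" "card {v \<in> V. u \<bullet> v = 1} = DIM('a)"
    "\<forall>v\<in>V. 0 \<le> c v" "x = (\<Sum>v \<in> {v \<in> V. u \<bullet> v = 1}. c v *\<^sub>R v)"
proof -
  let ?C = "convex hull V"
  have "x \<noteq> 0" using x[of "{}"] by auto
  moreover have compact: "compact ?C" using V by (simp add: finite_imp_compact_convex_hull)
  ultimately obtain r where r: "0 < r" "0 + r *\<^sub>R x \<in> frontier ?C"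
    using ray_to_frontier[OF compact_imp_bounded V(2), of x] by blast
  define y where "y = r *\<^sub>R x"
  have y: "y \<in> ?C" "y \<notin> interior ?C"
    using r compact by (auto simp: y_def frontier_def compact_imp_closed)
  have "rel_interior ?C = interior ?C"
    using V(2) by (intro rel_interior_nonempty_interior) auto
  then obtain a where a: "\<And>z. z \<in> ?C \<Longrightarrow> a \<bullet> y \<le> a \<bullet> z" "\<And>z. z \<in> interior ?C \<Longrightarrow> a \<bullet> y < a \<bullet> z"
    using supporting_hyperplane_relative_frontier[of ?C y] y compact
    by (metis closure_closed compact_imp_closed convex_convex_hull)
  have neg: "a \<bullet> y < 0" using a(2)[OF V(2)] by simp
  \<comment> \<open>Since 0 is interior, \<open>a \<bullet> y\<close> is negative; dividing by it
    reverses the inequality and puts the hyperplane at height 1.\<close>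
  define u where "u = (1 / (a \<bullet> y)) *\<^sub>R a"
  have uy: "u \<bullet> y = 1" using neg by (simp add: u_def)
  have u: "u \<bullet> v \<le> 1" if "v \<in> V" for v
    using a(1)[OF hull_inc[OF that]] neg by (simp add: u_def divide_le_eq)
  let ?J = "{v \<in> V. u \<bullet> v = 1}"
  obtain c where c: "\<And>v. v \<in> V \<Longrightarrow> 0 \<le> c v" "sum c V = 1" "(\<Sum>v\<in>V. c v *\<^sub>R v) = y"
    using y(1) V(1) by (auto simp: convex_hull_finite)
  \<comment> \<open>Complementary slackness: nonnegative terms with sum 0 all vanish, so
    \<open>c v\<close> is 0 off the hyperplane.\<close>
  have "(\<Sum>v\<in>V. c v * (1 - u \<bullet> v)) = sum c V - u \<bullet> (\<Sum>v\<in>V. c v *\<^sub>R v)"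
    by (simp add: right_diff_distrib sum_subtractf inner_sum_right)
  then have "(\<Sum>v\<in>V. c v * (1 - u \<bullet> v)) = 0" using c uy by simp
  then have "\<forall>v\<in>V. c v * (1 - u \<bullet> v) = 0"
    using V(1) c(1) u by (subst (asm) sum_nonneg_eq_0_iff) auto
  then have "(\<Sum>v\<in>V. c v *\<^sub>R v) = (\<Sum>v\<in>?J. c v *\<^sub>R v)"
    using V(1) by (intro sum.mono_neutral_right) auto
  then have "(1 / r) *\<^sub>R y = (1 / r) *\<^sub>R (\<Sum>v\<in>?J. c v *\<^sub>R v)" by (simp only: c(3))
  then have x_eq: "x = (\<Sum>v\<in>?J. (c v / r) *\<^sub>R v)"
    using r(1) by (simp add: scaleR_sum_right y_def)
  have "x \<in> span ?J" by (subst x_eq) (intro span_sum span_scale span_base)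
  then have "DIM('a) \<le> card ?J" using x[of ?J] by (cases "card ?J < DIM('a)") auto
  moreover have "card ?J \<le> DIM('a)" using independent_bound[OF generic] by blast
  ultimately have "card ?J = DIM('a)" by simp
  with u show ?thesis
    using c(1) r(1) by (intro that[OF _ _ _ x_eq]) simp_all
qed

text \<open>Up to a null set the gap is the disjoint union of the cone gaps over the facets, so the
  inequality for single cones can be summed. At order \<open>k + 1\<close> covering suffices;
  disjointness and inclusion are needed at order \<open>k\<close>.\<close>

lemma emeasure_gap_Suc_le:
  fixes S V :: "'a::euclidean_space set"
  assumes V: "finite V" "V \<subseteq> S" "S \<subseteq> convex hull V" "0 \<in> interior (convex hull V)"
    and generic: "\<And>u. independent {v \<in> V. u \<bullet> v = 1}"
    and star: "\<And>x t. x \<in> S \<Longrightarrow> 0 \<le> t \<Longrightarrow> t \<le> 1 \<Longrightarrow> t *\<^sub>R x \<in> S"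
    and S: "0 \<in> S" "compact S" and k: "DIM('a) \<le> k + 1"
  shows "emeasure lborel ((\<lambda>x. real (Suc k) *\<^sub>R x) ` (convex hull V) - iterated_sumset S (Suc k))
    \<le> ennreal (1 + (real DIM('a) - 1) / (real k + 2 - real DIM('a)))
      * emeasure lborel ((\<lambda>x. real k *\<^sub>R x) ` (convex hull V) - iterated_sumset S k)"
proof -
  let ?R = "ennreal (1 + (real DIM('a) - 1) / (real k + 2 - real DIM('a)))"
  let ?C = "convex hull V"
  define gap where "gap m = (\<lambda>x. real m *\<^sub>R x) ` ?C - iterated_sumset S m" for m
  \<comment> \<open>The vertex sets of the facets, each cut out by a functional with maximum 1 on
    \<open>V\<close>.\<close>
  define \<F> where "\<F> = {B. B \<subseteq> V \<and> card B = DIM('a) \<and> (\<exists>u. B = {v \<in> V. u \<bullet> v = 1} \<and> (\<forall>v\<in>V. u \<bullet> v \<le> 1))}"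
  \<comment> \<open>A null set that contains the walls between the cones, as well as all points to
    which \<open>ray_in_facet_cone\<close> does not apply.\<close>
  define N where "N = \<Union>(span ` {D. D \<subseteq> V \<and> card D < DIM('a)})"
  have \<F>: "independent B" "span B = UNIV" "finite B" "B \<subseteq> V" "card B = DIM('a)" if "B \<in> \<F>" for B
  proof -
    show "independent B" "B \<subseteq> V" "card B = DIM('a)" using that generic by (auto simp: \<F>_def)
    then show "span B = UNIV" "finite B"
      using card_ge_dim_independent[of B UNIV] independent_imp_finite by auto
  qed
  have fin: "finite \<F>" using V(1) by (simp add: \<F>_def)
  have [measurable]: "N \<in> sets borel"
    unfolding N_def using V(1) by (intro sets.finite_Union) (auto intro: borel_closed closed_span)
  have "negligible N"
    unfolding N_def
  proof (intro negligible_Union)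
    fix T assume "T \<in> span ` {D. D \<subseteq> V \<and> card D < DIM('a)}"
    then obtain D where D: "D \<subseteq> V" "card D < DIM('a)" "T = span D" by auto
    then have "dim T < DIM('a)"
      using dim_le_card[of D D] V(1) by (metis dim_span finite_subset le_less_trans span_superset)
    then show "negligible T" by (rule negligible_lowdim)
  qed (use V(1) in simp)
  then have N_null: "emeasure lborel N = 0"
    by (simp add: negligible_iff_emeasure0)
  have cone_sets: "cone_gap S B m \<in> sets borel" if "B \<in> \<F>" for B m
    using \<F>(1,2)[OF that] S(2) by (rule sets_cone_gap)
  then have [measurable]: "(\<Union>B\<in>\<F>. cone_gap S B m) \<in> sets borel" for m
    using fin by (intro sets.finite_UN) auto
  have gap_sets: "gap m \<in> sets borel" for m
    unfolding gap_def using V(1) S(2)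
    by (intro sets.Diff borel_closed compact_imp_closed compact_scaling compact_iterated_sumset
        finite_imp_compact_convex_hull)
  have zero: "0 \<in> ?C" using V(4) interior_subset by auto

  have rep_sum: "(\<Sum>b\<in>B. representation B x b *\<^sub>R b) = x" if "B \<in> \<F>" for B x
    using \<F>[OF that] by (intro sum_representation_eq) auto
  have subset: "cone_gap S B m \<subseteq> gap m" if "B \<in> \<F>" for B m
  proof
    fix x assume x: "x \<in> cone_gap S B m"
    have "(\<Sum>b\<in>B. representation B x b *\<^sub>R b) \<in> (\<lambda>x. real m *\<^sub>R x) ` ?C"
      using \<F>[OF that] x zero
      by (intro sum_scaleR_in_scaled_convex) (auto simp: cone_gap_def intro: hull_inc)
    then show "x \<in> gap m"
      using x rep_sum[OF that] by (simp add: gap_def cone_gap_def)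
  qed
  have cover: "gap m \<subseteq> N \<union> (\<Union>B\<in>\<F>. cone_gap S B m)" for m
  proof
    fix x assume x: "x \<in> gap m"
    show "x \<in> N \<union> (\<Union>B\<in>\<F>. cone_gap S B m)"
    proof (cases "x \<in> N")
      case False
      then have "x \<notin> span D" if "D \<subseteq> V" "card D < DIM('a)" for D
        using that by (auto simp: N_def)
      then obtain u c where u: "\<forall>v\<in>V. u \<bullet> v \<le> 1" "card {v \<in> V. u \<bullet> v = 1} = DIM('a)"
        and c: "\<forall>v\<in>V. 0 \<le> c v" "x = (\<Sum>v \<in> {v \<in> V. u \<bullet> v = 1}. c v *\<^sub>R v)"
        by (rule ray_in_facet_cone[OF V(1,4) generic]) blast
      define B where "B = {v \<in> V. u \<bullet> v = 1}"
      have B: "B \<in> \<F>" using u by (auto simp: \<F>_def B_def)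
      have rep: "representation B x b = c b" if "b \<in> B" for b
        using representation_eq_coeffs[OF \<F>(1,3)[OF B] that, of c] c(2) by (simp add: B_def)
      obtain y where y: "y \<in> ?C" "x = real m *\<^sub>R y" using x by (auto simp: gap_def)
      have "?C \<subseteq> {y. u \<bullet> y \<le> 1}"
        using u(1) by (intro hull_minimal) (auto simp: convex_halfspace_le)
      then have "u \<bullet> x \<le> real m" using y by (auto simp: mult_left_le)
      moreover have "u \<bullet> x = sum c B" by (simp add: c(2) inner_sum_right B_def)
      ultimately have "x \<in> cone_gap S B m"
        using x rep c(1) by (auto simp: cone_gap_def gap_def B_def)
      with B show ?thesis by blast
    qed simp
  qed
  \<comment> \<open>The functional \<open>u\<close> of the facet \<open>B\<close> reads off the
    coordinate sum with respect to \<open>B\<close>; evaluated on the expansion over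
    \<open>B'\<close> it gives at most the coordinate sum with respect to \<open>B'\<close>, as
    \<open>u\<close> is at most 1 on \<open>V\<close>. Equality with positive coordinates forces
    \<open>u = 1\<close> on \<open>B'\<close>.\<close>
  have sum_le: "sum (representation B x) B \<le> sum (representation B' x) B' \<and>
      ((\<forall>b\<in>B'. 0 < representation B' x b) \<longrightarrow> sum (representation B' x) B' \<le> sum (representation B x) B \<longrightarrow> B' \<subseteq> B)"
    if "B \<in> \<F>" "B' \<in> \<F>" "\<forall>b\<in>B'. 0 \<le> representation B' x b" for B B' x
  proof -
    obtain u where u: "B = {v \<in> V. u \<bullet> v = 1}" "\<And>v. v \<in> V \<Longrightarrow> u \<bullet> v \<le> 1"
      using \<open>B \<in> \<F>\<close> by (auto simp: \<F>_def)
    have "u \<bullet> x = u \<bullet> (\<Sum>b\<in>B. representation B x b *\<^sub>R b)"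
      by (simp only: rep_sum[OF that(1)])
    also have "\<dots> = sum (representation B x) B"
      by (simp add: inner_sum_right u(1))
    finally have 1: "u \<bullet> x = sum (representation B x) B" .
    have "u \<bullet> x = u \<bullet> (\<Sum>b\<in>B'. representation B' x b *\<^sub>R b)"
      by (simp only: rep_sum[OF that(2)])
    then have 2: "u \<bullet> x = (\<Sum>b\<in>B'. representation B' x b * (u \<bullet> b))"
      by (simp add: inner_sum_right)
    have le: "representation B' x b * (u \<bullet> b) \<le> representation B' x b" if "b \<in> B'" for b
      using that \<open>\<forall>b\<in>B'. _\<close> u(2) \<F>(4)[OF \<open>B' \<in> \<F>\<close>] by (auto intro: mult_left_le)
    have le_sum: "(\<Sum>b\<in>B'. representation B' x b * (u \<bullet> b)) \<le> sum (representation B' x) B'"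
      by (rule sum_mono[OF le])
    have "B' \<subseteq> B" if pos: "\<forall>b\<in>B'. 0 < representation B' x b"
      and ge: "sum (representation B' x) B' \<le> sum (representation B x) B"
    proof
      fix b assume b: "b \<in> B'"
      have "(\<Sum>b\<in>B'. representation B' x b * (u \<bullet> b)) = sum (representation B' x) B'"
        using 1 2 ge le_sum by linarith
      from sum_mono_inv[OF this le b \<F>(3)[OF \<open>B' \<in> \<F>\<close>]]
      have "representation B' x b * (u \<bullet> b) = representation B' x b" by simp
      then show "b \<in> B" using pos b \<F>(4)[OF \<open>B' \<in> \<F>\<close>] by (force simp: u(1))
    qed
    then show ?thesis using 1 2 le_sum by simp
  qed
  \<comment> \<open>A zero coordinate would place \<open>x\<close> in the span of
    \<open>d - 1\<close> vertices, which is part of \<open>N\<close>.\<close>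
  have pos: "0 < representation B x b" if "B \<in> \<F>" "x \<in> cone_gap S B m - N" "b \<in> B" for B x b m
  proof (rule ccontr)
    assume "\<not> 0 < representation B x b"
    then have "representation B x b = 0" using that by (force simp: cone_gap_def)
    then have "(\<Sum>c\<in>B. representation B x c *\<^sub>R c) = (\<Sum>c\<in>B - {b}. representation B x c *\<^sub>R c)"
      using \<F>(3)[OF that(1)] that(3) by (simp add: sum.remove)
    then have x_eq: "x = (\<Sum>c\<in>B - {b}. representation B x c *\<^sub>R c)"
      using rep_sum[OF that(1)] by metis
    have "x \<in> span (B - {b})"
      by (subst x_eq) (intro span_sum span_scale span_base)
    moreover have "card (B - {b}) < DIM('a)"
      using \<F>(3,5)[OF that(1)] that(3) by (metis card_Diff1_less)
    moreover have "B - {b} \<subseteq> V" using \<F>(4)[OF that(1)] by blast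
    ultimately have "x \<in> N" unfolding N_def by blast
    with that show False by simp
  qed
  have disjoint: "disjoint_family_on (\<lambda>B. cone_gap S B m - N) \<F>" for m
  proof (clarsimp simp: disjoint_family_on_def)
    fix B B' assume BB: "B \<in> \<F>" "B' \<in> \<F>" "B \<noteq> B'"
    show "(cone_gap S B m - N) \<inter> (cone_gap S B' m - N) = {}"
    proof (rule ccontr)
      assume "(cone_gap S B m - N) \<inter> (cone_gap S B' m - N) \<noteq> {}"
      then obtain x where x: "x \<in> cone_gap S B m - N" "x \<in> cone_gap S B' m - N" by blast
      have "\<forall>b\<in>B. 0 < representation B x b" "\<forall>b\<in>B'. 0 < representation B' x b"
        using pos[OF BB(1) x(1)] pos[OF BB(2) x(2)] by auto
      moreover from this have "\<forall>b\<in>B. 0 \<le> representation B x b" "\<forall>b\<in>B'. 0 \<le> representation B' x b"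
        using less_imp_le by blast+
      \<comment> \<open>Applied in both directions, \<open>sum_le\<close> makes the two coordinate
        sums equal and then yields both inclusions.\<close>
      ultimately have "B = B'"
        using sum_le[OF BB(1,2)] sum_le[OF BB(2,1)] by blast
      with BB show False by simp
    qed
  qed

  have "emeasure lborel (gap (Suc k)) \<le> emeasure lborel (N \<union> (\<Union>B\<in>\<F>. cone_gap S B (Suc k)))"
    by (intro emeasure_mono cover) simp
  also have "\<dots> \<le> emeasure lborel N + emeasure lborel (\<Union>B\<in>\<F>. cone_gap S B (Suc k))"
    by (intro emeasure_subadditive) simp_all
  also have "\<dots> = emeasure lborel (\<Union>B\<in>\<F>. cone_gap S B (Suc k))"
    by (simp add: N_null)
  also have "\<dots> \<le> (\<Sum>B\<in>\<F>. emeasure lborel (cone_gap S B (Suc k)))"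
    using fin cone_sets by (intro emeasure_subadditive_finite) auto
  also have "\<dots> \<le> (\<Sum>B\<in>\<F>. ?R * emeasure lborel (cone_gap S B k))"
  proof (intro sum_mono)
    fix B assume B: "B \<in> \<F>"
    have "B \<subseteq> S" using \<F>(4)[OF B] V(2) by blast
    then show "emeasure lborel (cone_gap S B (Suc k)) \<le> ?R * emeasure lborel (cone_gap S B k)"
      by (rule emeasure_cone_gap_Suc_le[OF \<F>(1,5)[OF B] _ star S k])
  qed
  also have "\<dots> = ?R * (\<Sum>B\<in>\<F>. emeasure lborel (cone_gap S B k))"
    by (rule sum_distrib_left[symmetric])
  also have "(\<Sum>B\<in>\<F>. emeasure lborel (cone_gap S B k)) = (\<Sum>B\<in>\<F>. emeasure lborel (cone_gap S B k - N))"
    using N_null cone_sets by (intro sum.cong refl emeasure_Diff_null_set[symmetric]) auto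
  also have "\<dots> = emeasure lborel (\<Union>B\<in>\<F>. cone_gap S B k - N)"
    using fin disjoint cone_sets by (intro sum_emeasure) auto
  also have "?R * \<dots> \<le> ?R * emeasure lborel (gap k)"
    using subset gap_sets by (intro mult_left_mono emeasure_mono) auto
  finally show ?thesis
    by (simp add: gap_def)
qed

subsection \<open>Approximation by generic stars\<close>

text \<open>Two different multiples of \<open>w\<close> span a line through 0 (or are both 0), so 0
  would be in the affine hull. Hence each affine hull that misses 0 rules out at most one scaling of
  a vector.\<close>

lemma unique_scaling_in_affine_hull:
  fixes w :: "'a::real_vector"
  assumes "0 \<notin> affine hull B" "s *\<^sub>R w \<in> affine hull B" "t *\<^sub>R w \<in> affine hull B"
  shows "s = t"
proof (rule ccontr)
  assume "s \<noteq> t"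
  have "(t / (t - s)) *\<^sub>R (s *\<^sub>R w) + (- s / (t - s)) *\<^sub>R (t *\<^sub>R w) \<in> affine hull B"
    using assms \<open>s \<noteq> t\<close>
    by (intro mem_affine[OF affine_affine_hull]) (auto simp: diff_divide_distrib[symmetric])
  moreover have "(t / (t - s)) *\<^sub>R (s *\<^sub>R w) + (- s / (t - s)) *\<^sub>R (t *\<^sub>R w) = 0"
    by (simp add: mult.commute)
  ultimately show False using assms(1) by (simp only:)
qed

text \<open>The vectors are stretched one after another, each time avoiding finitely many forbidden
  factors. Independence on every hyperplane \<open>u \<bullet> v = 1\<close> is what makes all
  facets simplices later on.\<close>

lemma exists_generic_scaling:
  fixes V :: "'a::real_inner set"
  assumes "finite V" "0 < \<eta>"
  obtains W where "finite W" "\<forall>u. independent {v \<in> W. u \<bullet> v = 1}"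
    "\<forall>w\<in>W. \<exists>v\<in>V. \<exists>t. 1 \<le> t \<and> t \<le> 1 + \<eta> \<and> w = t *\<^sub>R v"
    "\<forall>v\<in>V. \<exists>t. 1 \<le> t \<and> t \<le> 1 + \<eta> \<and> t *\<^sub>R v \<in> W"
proof -
  have "\<exists>W. finite W \<and> (\<forall>u. independent {v \<in> W. u \<bullet> v = 1}) \<and>
    (\<forall>w\<in>W. \<exists>v\<in>V. \<exists>t. 1 \<le> t \<and> t \<le> 1 + \<eta> \<and> w = t *\<^sub>R v) \<and>
    (\<forall>v\<in>V. \<exists>t. 1 \<le> t \<and> t \<le> 1 + \<eta> \<and> t *\<^sub>R v \<in> W)"
    using assms(1)
  proof (induction V rule: finite_induct)
    case empty
    then show ?case by (intro exI[of _ "{}"]) (auto simp: independent_empty)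
  next
    case (insert w V)
    then obtain W where W: "finite W" "\<And>u. independent {v \<in> W. u \<bullet> v = 1}"
      "\<And>w. w \<in> W \<Longrightarrow> \<exists>v\<in>V. \<exists>t. 1 \<le> t \<and> t \<le> 1 + \<eta> \<and> w = t *\<^sub>R v"
      "\<And>v. v \<in> V \<Longrightarrow> \<exists>t. 1 \<le> t \<and> t \<le> 1 + \<eta> \<and> t *\<^sub>R v \<in> W"
      by auto
    define bad where "bad = (\<Union>B \<in> {B \<in> Pow W. 0 \<notin> affine hull B}. {t. t *\<^sub>R w \<in> affine hull B})"
    have "finite bad"
      unfolding bad_def
    proof (intro finite_UN_I)
      fix B assume B: "B \<in> {B \<in> Pow W. 0 \<notin> affine hull B}"
      show "finite {t. t *\<^sub>R w \<in> affine hull B}"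
      proof (cases "{t. t *\<^sub>R w \<in> affine hull B} = {}")
        case False
        then obtain s where "s *\<^sub>R w \<in> affine hull B" by blast
        then have "{t. t *\<^sub>R w \<in> affine hull B} \<subseteq> {s}"
          using unique_scaling_in_affine_hull[of B] B by blast
        then show ?thesis by (rule finite_subset) simp
      qed simp
    qed (use W(1) in simp)
    moreover have "infinite {1..1 + \<eta>}" using assms(2) by (simp add: infinite_Icc)
    ultimately have "{1..1 + \<eta>} - bad \<noteq> {}" by (metis Diff_infinite_finite finite.emptyI)
    then obtain t where "t \<in> {1..1 + \<eta>}" "t \<notin> bad" by blast
    then have t: "1 \<le> t" "t \<le> 1 + \<eta>" "t \<notin> bad" by simp_all
    have "independent {v \<in> insert (t *\<^sub>R w) W. u \<bullet> v = 1}" for u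
    proof (cases "u \<bullet> (t *\<^sub>R w) = 1")
      case False
      then have "{v \<in> insert (t *\<^sub>R w) W. u \<bullet> v = 1} = {v \<in> W. u \<bullet> v = 1}" by blast
      then show ?thesis using W(2) by simp
    next
      case True
      define J where "J = {v \<in> W. u \<bullet> v = 1}"
      have "affine hull J \<subseteq> {x. u \<bullet> x = 1}"
        by (intro hull_minimal) (auto simp: J_def affine_hyperplane)
      then have zero: "0 \<notin> affine hull J" by auto
      \<comment> \<open>On the hyperplane a linear combination is automatically affine: applying
        \<open>u\<close> shows that its coefficients sum to 1. Membership in the span would thus
        make \<open>t\<close> a forbidden factor.\<close>
      have "t *\<^sub>R w \<notin> span J"
      proof
        assume "t *\<^sub>R w \<in> span J"
        moreover have fin: "finite J" using W(1) by (simp add: J_def)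
        ultimately obtain c where c: "t *\<^sub>R w = (\<Sum>v\<in>J. c v *\<^sub>R v)"
          by (auto simp: span_finite)
        have "u \<bullet> (t *\<^sub>R w) = sum c J"
          unfolding c by (simp add: inner_sum_right J_def)
        with True have "sum c J = 1" by simp
        with c fin have "t *\<^sub>R w \<in> affine hull J"
          by (auto simp: affine_hull_finite)
        moreover have "J \<subseteq> W" by (auto simp: J_def)
        ultimately show False using zero t(3) unfolding bad_def by blast
      qed
      moreover have "{v \<in> insert (t *\<^sub>R w) W. u \<bullet> v = 1} = insert (t *\<^sub>R w) J"
        using True by (auto simp: J_def)
      ultimately show ?thesis
        using W(2)[of u] by (simp add: independent_insert J_def[symmetric])
    qed
    with W t show ?case
      by (intro exI[of _ "insert (t *\<^sub>R w) W"]) (blast intro: finite.insertI)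
  qed
  then show ?thesis using that by blast
qed

text \<open>Around every point a small cube is the hull of finitely many points; by compactness the
  interiors of finitely many such cubes cover \<open>S\<close>.\<close>

lemma compact_in_interior_finite_hull:
  fixes S :: "'a::euclidean_space set"
  assumes "compact S" "0 < e"
  obtains V where "finite V" "V \<subseteq> (\<Union>x\<in>S. ball x e)" "S \<subseteq> interior (convex hull V)"
proof -
  have "\<exists>F. finite F \<and> F \<subseteq> ball s e \<and> s \<in> interior (convex hull F)" for s :: 'a
  proof -
    \<comment> \<open>With this half-width the l1 distance from the centre is at most
      \<open>e / 2\<close>, which keeps the cube inside the open ball.\<close>
    let ?d = "e / (2 * real DIM('a))"
    let ?r = "\<Sum>i\<in>Basis. ?d *\<^sub>R i :: 'a"
    have d: "0 < ?d" using assms(2) by simp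
    obtain F where F: "finite F" "cbox (s - ?r) (s + ?r) = convex hull F"
      using cube_convex_hull[OF d, of s] by blast
    have "cbox (s - ?r) (s + ?r) \<subseteq> ball s e"
    proof
      fix x assume x: "x \<in> cbox (s - ?r) (s + ?r)"
      have "\<bar>(s - x) \<bullet> i\<bar> \<le> ?d" if "i \<in> Basis" for i
        using x that by (auto simp: mem_box inner_simps inner_Basis inner_sum_left abs_le_iff
            if_distrib cong: if_cong)
      then have "norm (s - x) \<le> (\<Sum>i\<in>(Basis::'a set). ?d)"
        by (intro order_trans[OF norm_le_l1] sum_mono)
      then show "x \<in> ball s e" using assms(2) by (simp add: dist_norm)
    qed
    moreover have "F \<subseteq> convex hull F" by (rule hull_subset)
    moreover have "s \<in> box (s - ?r) (s + ?r)"
      using d by (auto simp: mem_box inner_simps inner_Basis inner_sum_left if_distrib cong: if_cong)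
    then have "s \<in> interior (convex hull F)"
      unfolding F(2)[symmetric] interior_cbox .
    ultimately show ?thesis using F by blast
  qed
  then obtain F where F: "\<And>s::'a. finite (F s)" "\<And>s. F s \<subseteq> ball s e" "\<And>s. s \<in> interior (convex hull (F s))"
    by metis
  have cover: "S \<subseteq> (\<Union>s\<in>S. interior (convex hull (F s)))"
    using F(3) by blast
  obtain T where T: "T \<subseteq> S" "finite T" "S \<subseteq> (\<Union>s\<in>T. interior (convex hull (F s)))"
    by (rule compactE_image[OF assms(1) _ cover]) auto
  show ?thesis
  proof (rule that[of "\<Union>(F ` T)"])
    show "finite (\<Union>(F ` T))" using T(2) F(1) by blast
    show "\<Union>(F ` T) \<subseteq> (\<Union>x\<in>S. ball x e)" using T(1) F(2) by blast
    have "interior (convex hull (F s)) \<subseteq> interior (convex hull \<Union>(F ` T))" if "s \<in> T" for s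
      using that by (intro interior_mono hull_mono) blast
    with T(3) show "S \<subseteq> interior (convex hull \<Union>(F ` T))" by blast
  qed
qed

subsection \<open>The growth ratio\<close>

text \<open>The binomial expansion cut after the quadratic term. Bernoulli's inequality is too weak
  here: for \<open>k = (d - 1) (d - 2)\<close> and \<open>d \<ge> 3\<close> the linear term
  \<open>d / k\<close> stays below \<open>(d - 1) / (k + 2 - d)\<close>.\<close>

lemma one_plus_power_ge:
  fixes x :: real
  assumes "0 \<le> x"
  shows "1 + real n * x + real n * (real n - 1) / 2 * x\<^sup>2 \<le> (1 + x) ^ n"
proof (induction n)
  case (Suc n)
  have "1 + real (Suc n) * x + real (Suc n) * (real (Suc n) - 1) / 2 * x\<^sup>2
      = (1 + x) * (1 + real n * x + real n * (real n - 1) / 2 * x\<^sup>2) - real n * (real n - 1) / 2 * x ^ 3"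
    by (simp add: field_simps power2_eq_square power3_eq_cube)
  also have "\<dots> \<le> (1 + x) * (1 + real n * x + real n * (real n - 1) / 2 * x\<^sup>2)"
    using assms by (cases n) auto
  also have "\<dots> \<le> (1 + x) * (1 + x) ^ n"
    using Suc assms by (intro mult_left_mono) auto
  finally show ?case by simp
qed simp

lemma growth_ratio_less:
  fixes d k :: nat
  assumes "2 \<le> d" "max 2 ((d - 1) * (d - 2)) \<le> k"
  shows "1 + (real d - 1) / (real k + 2 - real d) < (1 + 1 / real k) ^ d" and "d \<le> k + 1"
proof -
  show dk: "d \<le> k + 1"
  proof (cases "3 \<le> d")
    case True
    then have "(d - 1) * 1 \<le> (d - 1) * (d - 2)" by (intro mult_le_mono2) simp
    moreover have "(d - 1) * (d - 2) \<le> k" using assms(2) by simp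
    ultimately show ?thesis by linarith
  qed (use assms in simp)
  define D where "D = real d"
  define K where "K = real k"
  have D: "2 \<le> D" and K: "2 \<le> K" and DK: "D \<le> K + 1"
    using assms dk by (auto simp: D_def K_def)
  have "(D - 1) * (D - 2) = real ((d - 1) * (d - 2))"
    using assms by (simp add: D_def of_nat_diff)
  also have "\<dots> \<le> K"
    unfolding K_def using assms(2) by (intro of_nat_mono) simp
  finally have m: "(D - 1) * (D - 2) \<le> K" .
  \<comment> \<open>This is the desired inequality with denominators cleared. Using
    \<open>(D - 1) * (D - 2) \<le> K\<close> twice bounds the expression below by
    \<open>K * (D - 2)\<^sup>2\<close>, which is positive only for \<open>D > 2\<close>; hence the
    separate case.\<close>
  have "0 < 2 * K\<^sup>2 - D * (D - 3) * K - D * (D - 1) * (D - 2)"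
  proof (cases "d = 2")
    case True
    have "0 < 2 * K\<^sup>2 + 2 * K" using K by (intro add_pos_pos) auto
    with True show ?thesis by (simp add: D_def)
  next
    case False
    then have D3: "3 \<le> D" using assms by (simp add: D_def)
    have "D * ((D - 1) * (D - 2)) \<le> D * K" using m D by (intro mult_left_mono) auto
    moreover have "K * (2 * ((D - 1) * (D - 2))) \<le> K * (2 * K)" using m K by (intro mult_left_mono) auto
    moreover have "0 < K * (D - 2)\<^sup>2" using K D3 by simp
    ultimately show ?thesis by (simp add: algebra_simps power2_eq_square)
  qed
  then have "(D - 1) / (K + 2 - D) < D / K + D * (D - 1) / 2 * (1 / K)\<^sup>2"
    using K DK by (simp add: field_simps power2_eq_square)
  also have "\<dots> \<le> (1 + 1 / K) ^ d - 1"
    using one_plus_power_ge[of "1 / K" d] K by (simp add: D_def)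
  finally show "1 + (real d - 1) / (real k + 2 - real d) < (1 + 1 / real k) ^ d"
    by (simp add: D_def K_def)
qed

subsection \<open>Passage to the limit\<close>

text \<open>Upper semicontinuity of volume at a compact set: outer regularity supplies an open
  superset of small excess, and compactness leaves room for a uniform neighbourhood inside
  it.\<close>

lemma compact_measure_outer_le:
  fixes K :: "'a::euclidean_space set"
  assumes "compact K" "0 < \<delta>"
  obtains \<epsilon> where "0 < \<epsilon>"
    "\<And>L. compact L \<Longrightarrow> L \<subseteq> (\<Union>x\<in>K. cball x \<epsilon>) \<Longrightarrow> measure lebesgue L \<le> measure lebesgue K + \<delta>"
proof -
  have K: "K \<in> lmeasurable" using assms(1) by (rule lmeasurable_compact)
  obtain T where T: "open T" "K \<subseteq> T" "T - K \<in> lmeasurable" "emeasure lebesgue (T - K) < ennreal \<delta>"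
    using sets_lebesgue_outer_open[OF fmeasurableD[OF K] assms(2)] by blast
  obtain \<epsilon> where \<epsilon>: "0 < \<epsilon>" "(\<Union>x\<in>K. cball x \<epsilon>) \<subseteq> T"
    using compact_subset_open_imp_cball_epsilon_subset[OF assms(1) T(1,2)] by blast
  show ?thesis
  proof (rule that[OF \<epsilon>(1)])
    fix L assume L: "compact L" "L \<subseteq> (\<Union>x\<in>K. cball x \<epsilon>)"
    have "measure lebesgue (T - K) < \<delta>"
      using T(4) assms(2) emeasure_eq_measure2[OF T(3)] by (simp add: ennreal_less_iff)
    have "measure lebesgue L \<le> measure lebesgue (K \<union> (T - K))"
      using L \<epsilon>(2) K T(3) by (intro measure_mono_fmeasurable fmeasurable.Un)
        (auto dest: lmeasurable_compact fmeasurableD)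
    also have "\<dots> \<le> measure lebesgue K + measure lebesgue (T - K)"
      using K T(3) by (intro measure_Un_le) (auto dest: fmeasurableD)
    finally show "measure lebesgue L \<le> measure lebesgue K + \<delta>"
      using \<open>measure lebesgue (T - K) < \<delta>\<close> by simp
  qed
qed

lemma iterated_sumset_thickening:
  fixes A B :: "'a::real_normed_vector set"
  assumes "B \<subseteq> (\<Union>x\<in>A. cball x \<epsilon>)"
  shows "iterated_sumset B m \<subseteq> (\<Union>x\<in>iterated_sumset A m. cball x (real m * \<epsilon>))"
proof
  fix y assume "y \<in> iterated_sumset B m"
  then obtain b where b: "\<forall>i<m. b i \<in> B" "y = (\<Sum>i<m. b i)"
    by (auto simp: iterated_sumset_def)
  then have "\<forall>i. \<exists>a. i < m \<longrightarrow> a \<in> A \<and> dist a (b i) \<le> \<epsilon>" using assms by fastforce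
  then obtain a where a: "\<And>i. i < m \<Longrightarrow> a i \<in> A \<and> dist (a i) (b i) \<le> \<epsilon>" by metis
  have "dist (\<Sum>i<m. a i) (\<Sum>i<m. b i) \<le> (\<Sum>i<m. \<epsilon>)"
    unfolding dist_norm sum_subtractf[symmetric]
    using a by (intro order_trans[OF norm_sum] sum_mono) (auto simp: dist_norm)
  moreover have "(\<Sum>i<m. a i) \<in> iterated_sumset A m"
    using a by (auto simp: iterated_sumset_def)
  ultimately show "y \<in> (\<Union>x\<in>iterated_sumset A m. cball x (real m * \<epsilon>))"
    using b(2) by auto
qed

text \<open>The closed neighbourhood of the hull is a Minkowski sum of two convex sets, hence
  convex.\<close>

lemma convex_hull_thickening:
  fixes A B :: "'a::real_normed_vector set"
  assumes "B \<subseteq> (\<Union>x\<in>A. cball x \<epsilon>)"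
  shows "convex hull B \<subseteq> (\<Union>x\<in>convex hull A. cball x \<epsilon>)"
proof (rule hull_minimal)
  have eq: "(\<Union>x\<in>convex hull A. cball x \<epsilon>) = (\<Union>x\<in>convex hull A. \<Union>y\<in>cball 0 \<epsilon>. {x + y})"
    by (simp only: UNION_singleton_eq_range image_add_cball add_0_left)
  show "convex (\<Union>x\<in>convex hull A. cball x \<epsilon>)"
    unfolding eq by (intro convex_sums convex_convex_hull convex_cball)
  show "B \<subseteq> (\<Union>x\<in>convex hull A. cball x \<epsilon>)"
    using assms hull_subset[of A convex] by blast
qed

text \<open>Stretching vertices outward does not lose the origin: a functional positive on
  \<open>W\<close> would be positive on \<open>V\<close>. With 0 in the new hull, each
  \<open>v\<close> is on the segment from 0 to its stretched copy.\<close>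

lemma hull_subset_hull_scaled:
  fixes V W :: "'a::euclidean_space set"
  assumes "finite W" "0 \<in> convex hull V"
    and up: "\<And>v. v \<in> V \<Longrightarrow> \<exists>t\<ge>1. t *\<^sub>R v \<in> W"
  shows "convex hull V \<subseteq> convex hull W"
proof -
  have zero: "0 \<in> convex hull W"
  proof (rule ccontr)
    assume "0 \<notin> convex hull W"
    then obtain a b where ab: "0 < b" "\<forall>x\<in>convex hull W. b < a \<bullet> x"
      using separating_hyperplane_closed_0[of "convex hull W"] assms(1)
      by (auto simp: finite_imp_compact_convex_hull compact_imp_closed)
    have "0 < a \<bullet> v" if v: "v \<in> V" for v
    proof -
      obtain t where t: "1 \<le> t" "t *\<^sub>R v \<in> W" using up[OF v] by blast
      then have "0 < t * (a \<bullet> v)" using ab hull_inc[OF t(2), of convex] by fastforce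
      with t(1) show ?thesis by (simp add: zero_less_mult_iff)
    qed
    then have "convex hull V \<subseteq> {x. 0 < a \<bullet> x}"
      by (intro hull_minimal) (auto simp: convex_halfspace_gt)
    with assms(2) show False by auto
  qed
  show ?thesis
  proof (intro hull_minimal subsetI)
    fix v assume v: "v \<in> V"
    obtain t where t: "1 \<le> t" "t *\<^sub>R v \<in> W" using up[OF v] by blast
    have "(1 - 1 / t) *\<^sub>R 0 + (1 / t) *\<^sub>R (t *\<^sub>R v) \<in> convex hull W"
      using zero t hull_inc[OF t(2)] by (intro convexD[OF convex_convex_hull]) auto
    then show "v \<in> convex hull W" using t(1) by simp
  qed simp
qed

text \<open>Adding only finitely many segments from the origin to \<open>S\<close> is enough, since just the convex hull has to
  become a polytope.\<close>

lemma exists_generic_fattening: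
  fixes S :: "'a::euclidean_space set"
  assumes S: "compact S" "0 \<in> S" and star: "\<And>x t. x \<in> S \<Longrightarrow> 0 \<le> t \<Longrightarrow> t \<le> 1 \<Longrightarrow> t *\<^sub>R x \<in> S"
    and "0 < \<epsilon>"
  obtains S' W where "finite W" "W \<subseteq> S'" "S' \<subseteq> convex hull W" "0 \<in> interior (convex hull W)"
    "\<And>u. independent {v \<in> W. u \<bullet> v = 1}" "compact S'" "S \<subseteq> S'" "S' \<subseteq> (\<Union>x\<in>S. cball x \<epsilon>)"
    "\<And>x t. x \<in> S' \<Longrightarrow> 0 \<le> t \<Longrightarrow> t \<le> 1 \<Longrightarrow> t *\<^sub>R x \<in> S'"
proof -
  obtain V where V: "finite V" "V \<subseteq> (\<Union>x\<in>S. ball x (\<epsilon> / 2))" "S \<subseteq> interior (convex hull V)"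
    using compact_in_interior_finite_hull[OF S(1), of "\<epsilon> / 2"] assms(4) by auto
  obtain M where M: "0 < M" "\<And>v. v \<in> V \<Longrightarrow> norm v \<le> M"
    using finite_imp_bounded[OF V(1)] by (auto simp: bounded_pos)
  \<comment> \<open>Stretching then moves each vertex by at most
    \<open>\<eta> * M = \<epsilon> / 2\<close>; the other half of \<open>\<epsilon>\<close> was
    spent on the choice of \<open>V\<close>.\<close>
  define \<eta> where "\<eta> = \<epsilon> / (2 * M)"
  have "0 < \<eta>" using assms(4) M(1) by (simp add: \<eta>_def)
  then obtain W where W: "finite W" "\<forall>u. independent {v \<in> W. u \<bullet> v = 1}"
    and down: "\<forall>w\<in>W. \<exists>v\<in>V. \<exists>t. 1 \<le> t \<and> t \<le> 1 + \<eta> \<and> w = t *\<^sub>R v"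
    and up: "\<forall>v\<in>V. \<exists>t. 1 \<le> t \<and> t \<le> 1 + \<eta> \<and> t *\<^sub>R v \<in> W"
    by (rule exists_generic_scaling[OF V(1)])
  have W_near: "\<exists>x\<in>S. dist x w \<le> \<epsilon>" if w: "w \<in> W" for w
  proof -
    obtain v t where v: "v \<in> V" "1 \<le> t" "t \<le> 1 + \<eta>" "w = t *\<^sub>R v" using down w by blast
    obtain x where x: "x \<in> S" "dist x v < \<epsilon> / 2" using V(2) v(1) by auto
    have "v - w = (1 - t) *\<^sub>R v" by (simp add: v(4) scaleR_left_diff_distrib)
    then have "dist v w = (t - 1) * norm v" using v(2) by (simp add: dist_norm)
    also have "\<dots> \<le> \<eta> * M" using v M by (intro mult_mono) auto
    also have "\<dots> = \<epsilon> / 2" using M(1) by (simp add: \<eta>_def)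
    finally have "dist x w \<le> \<epsilon>" using x(2) dist_triangle[of x w v] by simp
    with x(1) show ?thesis by blast
  qed
  have "0 \<in> convex hull V" using V(3) S(2) interior_subset by blast
  then have "convex hull V \<subseteq> convex hull W"
    using up by (intro hull_subset_hull_scaled W(1)) blast+
  then have SW: "S \<subseteq> interior (convex hull W)"
    using V(3) interior_mono by blast
  have SW': "S \<subseteq> convex hull W" using SW interior_subset by blast
  define S' where "S' = S \<union> (\<Union>w\<in>W. closed_segment 0 w)"
  show ?thesis
  proof (rule that[of W S'])
    show "finite W" "independent {v \<in> W. u \<bullet> v = 1}" for u using W by blast+
    show "W \<subseteq> S'" "S \<subseteq> S'" by (auto simp: S'_def)
    show "0 \<in> interior (convex hull W)" using SW S(2) by blast
    have "closed_segment 0 w \<subseteq> convex hull W" if "w \<in> W" for w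
      using that SW' S(2) by (intro closed_segment_subset) (auto intro: hull_inc)
    then show "S' \<subseteq> convex hull W" using SW' by (auto simp: S'_def)
    show "compact S'" using S(1) W(1) by (auto simp: S'_def intro!: compact_UN)
    show "S' \<subseteq> (\<Union>x\<in>S. cball x \<epsilon>)"
    proof
      fix y assume "y \<in> S'"
      then consider "y \<in> S" | w t where "w \<in> W" "0 \<le> t" "t \<le> 1" "y = t *\<^sub>R w"
        by (auto simp: S'_def in_segment)
      then show "y \<in> (\<Union>x\<in>S. cball x \<epsilon>)"
      proof cases
        case 1
        then show ?thesis using assms(4) by (intro UN_I[of y]) auto
      next
        case (2 w t)
        obtain x where x: "x \<in> S" "dist x w \<le> \<epsilon>" using W_near[OF 2(1)] by blast
        \<comment> \<open>The whole segment to \<open>w\<close> stays near \<open>S\<close> because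
          the point \<open>x\<close> near \<open>w\<close> may be shrunk along with it.\<close>
        have "dist (t *\<^sub>R x) y = t * dist x w"
          using 2(2) by (simp add: 2(4) dist_norm flip: scaleR_right_diff_distrib)
        also have "\<dots> \<le> 1 * dist x w" using 2 by (intro mult_right_mono) auto
        finally have "dist (t *\<^sub>R x) y \<le> \<epsilon>" using x(2) by simp
        with star[OF x(1) 2(2,3)] show ?thesis by auto
      qed
    qed
    show "t *\<^sub>R x \<in> S'" if x: "x \<in> S'" and t: "0 \<le> t" "t \<le> 1" for x t
    proof (cases "x \<in> S")
      case False
      then obtain w s where w: "w \<in> W" "0 \<le> s" "s \<le> 1" "x = s *\<^sub>R w"
        using x by (auto simp: S'_def in_segment)
      have "t * s \<le> 1" using mult_le_one[OF t(2) w(2,3)] .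
      then have "t *\<^sub>R x \<in> closed_segment 0 w"
        using w t(1) by (auto simp: in_segment intro!: exI[of _ "t * s"])
      then show ?thesis using w(1) by (auto simp: S'_def)
    qed (use star t in \<open>auto simp: S'_def\<close>)
  qed
qed

section \<open>Volumes of scaled sets and of differences of compact sets\<close>

lemma measure_scaled_set:
  fixes A :: "'a::euclidean_space set"
  shows "measure lebesgue ((\<lambda>x. real m *\<^sub>R x) ` A) = real m ^ DIM('a) * measure lebesgue A"
  using measure_lebesgue_affine[of "real m" 0 A] by simp

lemma measure_iterated_sumset:
  fixes A :: "'a::euclidean_space set"
  assumes "0 < m"
  shows "measure lebesgue (iterated_sumset A m) = real m ^ DIM('a) * measure lebesgue (sumset_average A m)"
  using measure_scaled_set[of m "sumset_average A m"] scaleR_sumset_average[OF assms, of A] by simp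

lemma iterated_sumset_subset_scaled_hull:
  assumes "0 < m"
  shows "iterated_sumset A m \<subseteq> (\<lambda>x. real m *\<^sub>R x) ` (convex hull A)"
  unfolding scaleR_sumset_average[OF assms, symmetric]
  by (intro image_mono sumset_average_subset_hull assms)

lemma emeasure_lborel_compact_Diff:
  fixes A B :: "'a::euclidean_space set"
  assumes "compact A" "compact B" "B \<subseteq> A"
  shows "emeasure lborel (A - B) = ennreal (measure lebesgue A - measure lebesgue B)"
proof -
  have "A - B \<in> sets borel"
    using assms by (intro sets.Diff) (auto dest: compact_imp_closed)
  then have "emeasure lborel (A - B) = emeasure lebesgue (A - B)" by simp
  also have "\<dots> = ennreal (measure lebesgue (A - B))"
    using assms by (intro emeasure_eq_measure2 fmeasurable.Diff lmeasurable_compact)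
  also have "measure lebesgue (A - B) = measure lebesgue A - measure lebesgue B"
    using assms by (intro measurable_measure_Diff) (auto intro: lmeasurable_compact fmeasurableD)
  finally show ?thesis .
qed

lemma measure_compact_mono:
  fixes A B :: "'a::euclidean_space set"
  assumes "A \<subseteq> B" "compact A" "compact B"
  shows "measure lebesgue A \<le> measure lebesgue B"
  using assms by (intro measure_mono_fmeasurable) (auto intro: lmeasurable_compact fmeasurableD)

text \<open>The polytope inequality is applied to a star \<open>T\<close> slightly larger than
  \<open>S\<close>. One-sided estimates suffice: two of the four volumes are compared by inclusion
  of \<open>S\<close> in \<open>T\<close>, the other two by outer regularity.\<close>

lemma measure_gap_Suc_le:
  fixes S :: "'a::euclidean_space set"
  assumes S: "compact S" "0 \<in> S" and star: "\<And>x t. x \<in> S \<Longrightarrow> 0 \<le> t \<Longrightarrow> t \<le> 1 \<Longrightarrow> t *\<^sub>R x \<in> S"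
    and k: "0 < k" "DIM('a) \<le> k + 1"
  shows "measure lebesgue ((\<lambda>x. real (Suc k) *\<^sub>R x) ` (convex hull S)) - measure lebesgue (iterated_sumset S (Suc k))
    \<le> (1 + (real DIM('a) - 1) / (real k + 2 - real DIM('a)))
      * (measure lebesgue ((\<lambda>x. real k *\<^sub>R x) ` (convex hull S)) - measure lebesgue (iterated_sumset S k))"
    (is "?a1 - ?b1 \<le> ?R * (?a0 - ?b0)")
proof -
  have R: "1 \<le> ?R" using k DIM_positive[where 'a = 'a] by (simp add: Suc_leI)
  have approx: "?a1 - (?b1 + \<delta>) \<le> ?R * (?a0 + \<delta> - ?b0)" if \<delta>: "0 < \<delta>" for \<delta>
  proof -
    obtain \<epsilon>1 where \<epsilon>1: "0 < \<epsilon>1" and outer1: "\<And>L. compact L \<Longrightarrow>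
        L \<subseteq> (\<Union>x\<in>iterated_sumset S (Suc k). cball x \<epsilon>1) \<Longrightarrow> measure lebesgue L \<le> ?b1 + \<delta>"
      by (rule compact_measure_outer_le[OF compact_iterated_sumset[OF S(1)] \<delta>]) blast
    obtain \<epsilon>0 where \<epsilon>0: "0 < \<epsilon>0" and outer0: "\<And>L. compact L \<Longrightarrow>
        L \<subseteq> (\<Union>x\<in>(\<lambda>x. real k *\<^sub>R x) ` (convex hull S). cball x \<epsilon>0) \<Longrightarrow> measure lebesgue L \<le> ?a0 + \<delta>"
      by (rule compact_measure_outer_le[OF compact_scaling[OF compact_convex_hull[OF S(1)]] \<delta>]) blast
    \<comment> \<open>The divisor compensates for the growth of errors: a sum of
      \<open>k + 1\<close> points is off by up to \<open>(k + 1) * \<epsilon>\<close>, a point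
      scaled by \<open>k\<close> by up to \<open>k * \<epsilon>\<close>.\<close>
    define \<epsilon> where "\<epsilon> = min \<epsilon>0 \<epsilon>1 / real (Suc k)"
    have \<epsilon>: "0 < \<epsilon>" using \<epsilon>0 \<epsilon>1 by (simp add: \<epsilon>_def)
    have "real (Suc k) * \<epsilon> = min \<epsilon>0 \<epsilon>1" by (simp add: \<epsilon>_def)
    then have le1: "real (Suc k) * \<epsilon> \<le> \<epsilon>1" and "real (Suc k) * \<epsilon> \<le> \<epsilon>0" by simp_all
    then have le0: "real k * \<epsilon> \<le> \<epsilon>0" using \<epsilon> by (simp add: algebra_simps)
    obtain T W where W: "finite W" "W \<subseteq> T" "T \<subseteq> convex hull W" "0 \<in> interior (convex hull W)"
      "\<And>u. independent {v \<in> W. u \<bullet> v = 1}"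
      and T: "compact T" "S \<subseteq> T" "T \<subseteq> (\<Union>x\<in>S. cball x \<epsilon>)"
        "\<And>x t. x \<in> T \<Longrightarrow> 0 \<le> t \<Longrightarrow> t \<le> 1 \<Longrightarrow> t *\<^sub>R x \<in> T"
      by (rule exists_generic_fattening[OF S star \<epsilon>]) blast+
    let ?H = "convex hull W"
    have H: "compact ?H" using W(1) by (rule finite_imp_compact_convex_hull)
    have hullT: "convex hull T = ?H"
      using W(2,3) by (intro antisym hull_minimal hull_mono) auto
    have sub: "iterated_sumset T m \<subseteq> (\<lambda>x. real m *\<^sub>R x) ` ?H" if "0 < m" for m
      using iterated_sumset_subset_scaled_hull[OF that, of T] by (simp only: hullT)
    have gap: "emeasure lborel ((\<lambda>x. real m *\<^sub>R x) ` ?H - iterated_sumset T m)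
        = ennreal (measure lebesgue ((\<lambda>x. real m *\<^sub>R x) ` ?H) - measure lebesgue (iterated_sumset T m))"
      if "0 < m" for m
      by (intro emeasure_lborel_compact_Diff compact_scaling H compact_iterated_sumset T(1) sub that)
    have nonneg: "0 \<le> measure lebesgue ((\<lambda>x. real m *\<^sub>R x) ` ?H) - measure lebesgue (iterated_sumset T m)"
      if "0 < m" for m
      using measure_compact_mono[OF sub[OF that]] H T(1) by (simp add: compact_scaling compact_iterated_sumset)
    have "0 \<in> T" using S(2) T(2) by blast
    then have "ennreal (measure lebesgue ((\<lambda>x. real (Suc k) *\<^sub>R x) ` ?H) - measure lebesgue (iterated_sumset T (Suc k)))
      \<le> ennreal ?R * ennreal (measure lebesgue ((\<lambda>x. real k *\<^sub>R x) ` ?H) - measure lebesgue (iterated_sumset T k))"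
      using emeasure_gap_Suc_le[OF W T(4) _ T(1) k(2)]
      by (simp only: gap[OF zero_less_Suc] gap[OF k(1)])
    also have "\<dots> = ennreal (?R * (measure lebesgue ((\<lambda>x. real k *\<^sub>R x) ` ?H) - measure lebesgue (iterated_sumset T k)))"
      using R nonneg[OF k(1)] by (intro ennreal_mult[symmetric]) auto
    finally have "measure lebesgue ((\<lambda>x. real (Suc k) *\<^sub>R x) ` ?H) - measure lebesgue (iterated_sumset T (Suc k))
      \<le> ?R * (measure lebesgue ((\<lambda>x. real k *\<^sub>R x) ` ?H) - measure lebesgue (iterated_sumset T k))"
      using R nonneg[OF k(1)] by (subst (asm) ennreal_le_iff) auto
    moreover have "?a1 \<le> measure lebesgue ((\<lambda>x. real (Suc k) *\<^sub>R x) ` ?H)"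
      using T(2) H S(1) unfolding hullT[symmetric]
      by (intro measure_compact_mono image_mono hull_mono compact_scaling compact_convex_hull T(1))
    moreover have "measure lebesgue (iterated_sumset T (Suc k)) \<le> ?b1 + \<delta>"
    proof (rule outer1)
      have "(\<Union>x\<in>iterated_sumset S (Suc k). cball x (real (Suc k) * \<epsilon>))
          \<subseteq> (\<Union>x\<in>iterated_sumset S (Suc k). cball x \<epsilon>1)"
        by (intro UN_mono subset_cball le1 order_refl)
      with iterated_sumset_thickening[OF T(3), of "Suc k"]
      show "iterated_sumset T (Suc k) \<subseteq> (\<Union>x\<in>iterated_sumset S (Suc k). cball x \<epsilon>1)"
        by (rule order_trans)
    qed (intro compact_iterated_sumset T(1))
    moreover have "measure lebesgue ((\<lambda>x. real k *\<^sub>R x) ` ?H) \<le> ?a0 + \<delta>"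
    proof (rule outer0)
      show "(\<lambda>x. real k *\<^sub>R x) ` ?H \<subseteq> (\<Union>x\<in>(\<lambda>x. real k *\<^sub>R x) ` (convex hull S). cball x \<epsilon>0)"
      proof clarify
        fix y assume "y \<in> ?H"
        then obtain x where x: "x \<in> convex hull S" "dist x y \<le> \<epsilon>"
          using convex_hull_thickening[OF T(3)] by (auto simp: hullT)
        have "dist (real k *\<^sub>R x) (real k *\<^sub>R y) = real k * dist x y"
          by (simp add: dist_norm flip: scaleR_right_diff_distrib)
        also have "\<dots> \<le> real k * \<epsilon>" using x(2) by (intro mult_left_mono) auto
        also note le0
        finally show "real k *\<^sub>R y \<in> (\<Union>x\<in>(\<lambda>x. real k *\<^sub>R x) ` (convex hull S). cball x \<epsilon>0)"
          using x(1) by auto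
      qed
    qed (intro compact_scaling H)
    moreover have "?b0 \<le> measure lebesgue (iterated_sumset T k)"
      by (intro measure_compact_mono iterated_sumset_mono T compact_iterated_sumset S)
    ultimately show ?thesis
      using R by (smt (verit) mult_left_mono)
  qed
  show ?thesis
  proof (rule field_le_epsilon)
    fix e :: real assume e: "0 < e"
    \<comment> \<open>This choice makes the total error \<open>\<delta> + ?R * \<delta>\<close>
      equal to \<open>e\<close>.\<close>
    have "?a1 - (?b1 + e / (1 + ?R)) \<le> ?R * (?a0 + e / (1 + ?R) - ?b0)"
      using e R by (intro approx divide_pos_pos) auto
    moreover have "?R * (?a0 + e / (1 + ?R) - ?b0) = ?R * (?a0 - ?b0) + ?R * (e / (1 + ?R))"
      by (simp only: distrib_left right_diff_distrib)
    moreover have "e / (1 + r) + r * (e / (1 + r)) = e" if "1 \<le> r" for r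
      using that by (simp add: add_divide_distrib[symmetric] field_simps)
    from this[OF R] have "e / (1 + ?R) + ?R * (e / (1 + ?R)) = e" .
    ultimately show "?a1 - ?b1 \<le> ?R * (?a0 - ?b0) + e" by linarith
  qed
qed

subsection \<open>Monotonicity and the equality case\<close>

text \<open>In lower dimension both sets are null. Otherwise the hull is the closure of its
  interior, and the part of the interior missed by the closed average is open and null, hence
  empty.\<close>

lemma measure_average_eq_hull_iff:
  fixes S :: "'a::euclidean_space set"
  assumes "compact S" "0 \<in> S" "0 < k"
  shows "measure lebesgue (sumset_average S k) = measure lebesgue (convex hull S)
    \<longleftrightarrow> aff_dim S < int DIM('a) \<or> sumset_average S k = convex hull S"
proof -
  let ?A = "sumset_average S k" and ?C = "convex hull S"
  have A: "compact ?A" and C: "compact ?C"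
    using assms(1) by (auto intro: compact_sumset_average compact_convex_hull)
  have AC: "?A \<subseteq> ?C" using assms(3) by (rule sumset_average_subset_hull)
  show ?thesis
  proof (intro iffI)
    assume "aff_dim S < int DIM('a) \<or> ?A = ?C"
    then show "measure lebesgue ?A = measure lebesgue ?C"
    proof
      assume "aff_dim S < int DIM('a)"
      then have "dim S < DIM('a)" using aff_dim_zero[OF hull_inc[OF assms(2)]] by simp
      then have "negligible (span S)" by (intro negligible_lowdim) (simp add: dim_span)
      then have "negligible ?C" using convex_hull_subset_span by (rule negligible_subset)
      then have "negligible ?A" using AC by (rule negligible_subset)
      with \<open>negligible ?C\<close> show ?thesis by (simp add: negligible_imp_measure0)
    qed simp
  next
    assume eq: "measure lebesgue ?A = measure lebesgue ?C"
    have "?A = ?C" if "\<not> aff_dim S < int DIM('a)"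
    proof -
      have "aff_dim S = DIM('a)" using that aff_dim_le_DIM[of S] by simp
      then have "affine hull ?C = UNIV"
        by (simp add: aff_dim_eq_full affine_hull_convex_hull)
      then have "interior ?C \<noteq> {}"
        using rel_interior_interior[of ?C] rel_interior_eq_empty[of ?C] assms(2) by auto
      then have closure: "closure (interior ?C) = ?C"
        using convex_closure_interior[of ?C] C by (simp add: compact_imp_closed)
      have "measure lebesgue (?C - ?A) = 0"
        using eq A C AC by (subst measurable_measure_Diff) (auto intro: lmeasurable_compact fmeasurableD)
      then have "negligible (?C - ?A)"
        using A C by (subst negligible_iff_measure0) (auto intro: fmeasurable.Diff lmeasurable_compact)
      then have "negligible (interior ?C - ?A)"
        by (rule negligible_subset) (use interior_subset in blast)
      moreover have "open (interior ?C - ?A)"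
        using A by (intro open_Diff compact_imp_closed) auto
      ultimately have "interior ?C \<subseteq> ?A" using open_not_negligible by blast
      then have "closure (interior ?C) \<subseteq> ?A"
        using A by (intro closure_minimal compact_imp_closed)
      with closure AC show ?thesis by simp
    qed
    then show "aff_dim S < int DIM('a) \<or> ?A = ?C" by blast
  qed
qed

text \<open>The deficit \<open>c - \<alpha> m\<close> against the hull strictly decreases from
  \<open>k\<close> to \<open>k + 1\<close> unless it is 0 at \<open>k\<close>, in which case it
  stays 0. So equal volumes mean zero deficit at \<open>k\<close>.\<close>

lemma measure_sumset_average_mono_origin:
  fixes S :: "'a::euclidean_space set"
  assumes d: "2 \<le> DIM('a)" and k: "max 2 ((DIM('a) - 1) * (DIM('a) - 2)) \<le> k"
    and S: "compact S" "0 \<in> S" and star: "\<And>x t. x \<in> S \<Longrightarrow> 0 \<le> t \<Longrightarrow> t \<le> 1 \<Longrightarrow> t *\<^sub>R x \<in> S"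
  shows "measure lebesgue (sumset_average S k) \<le> measure lebesgue (sumset_average S (k + 1)) \<and>
    (measure lebesgue (sumset_average S (k + 1)) = measure lebesgue (sumset_average S k)
      \<longleftrightarrow> aff_dim S < int DIM('a) \<or> sumset_average S k = convex hull S)"
proof -
  let ?d = "DIM('a)"
  let ?R = "1 + (real ?d - 1) / (real k + 2 - real ?d)"
  define c where "c = measure lebesgue (convex hull S)"
  define \<alpha> where "\<alpha> m = measure lebesgue (sumset_average S m)" for m
  have k0: "0 < k" using k by simp
  have \<alpha>_le: "\<alpha> m \<le> c" if "0 < m" for m
    unfolding \<alpha>_def c_def using S(1)
    by (intro measure_compact_mono sumset_average_subset_hull compact_sumset_average compact_convex_hull that)
  have R: "?R * real k ^ ?d < real (Suc k) ^ ?d"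
  proof -
    have "?R * real k ^ ?d < (1 + 1 / real k) ^ ?d * real k ^ ?d"
      using growth_ratio_less(1)[OF d k] k0 by (intro mult_strict_right_mono) auto
    also have "\<dots> = real (Suc k) ^ ?d"
      using k0 by (simp add: field_simps flip: power_mult_distrib)
    finally show ?thesis .
  qed
  \<comment> \<open>The gap inequality in terms of averages; scaling by \<open>m\<close> contributes
    the factor \<open>m ^ d\<close>.\<close>
  have main: "real (Suc k) ^ ?d * (c - \<alpha> (Suc k)) \<le> ?R * real k ^ ?d * (c - \<alpha> k)"
    using measure_gap_Suc_le[OF S star k0 growth_ratio_less(2)[OF d k]]
    unfolding measure_scaled_set measure_iterated_sumset[OF k0] measure_iterated_sumset[OF zero_less_Suc]
    by (simp add: c_def \<alpha>_def right_diff_distrib mult.assoc)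
  have strict: "\<alpha> k < \<alpha> (Suc k)" if "\<alpha> k < c"
  proof -
    have "?R * real k ^ ?d * (c - \<alpha> k) < real (Suc k) ^ ?d * (c - \<alpha> k)"
      using R that by (intro mult_strict_right_mono) auto
    with main have "real (Suc k) ^ ?d * (c - \<alpha> (Suc k)) < real (Suc k) ^ ?d * (c - \<alpha> k)" by linarith
    then show ?thesis by (simp add: mult_less_cancel_left del: of_nat_Suc)
  qed
  have equal: "\<alpha> (Suc k) = \<alpha> k" if "\<alpha> k = c"
  proof -
    have "real (Suc k) ^ ?d * (c - \<alpha> (Suc k)) \<le> 0" using main that by simp
    moreover have "0 < real (Suc k) ^ ?d" by simp
    ultimately have "c \<le> \<alpha> (Suc k)" unfolding mult_le_0_iff by linarith
    with \<alpha>_le[of "Suc k"] that show ?thesis by simp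
  qed
  have "\<alpha> k \<le> \<alpha> (Suc k)" "\<alpha> (Suc k) = \<alpha> k \<longleftrightarrow> \<alpha> k = c"
    using strict equal \<alpha>_le[OF k0] by fastforce+
  then show ?thesis
    using measure_average_eq_hull_iff[OF S k0] by (simp add: \<alpha>_def c_def)
qed

theorem theorem1:
  fixes S :: "(real ^ 'n) set" and k :: nat
  assumes "CARD('n) \<ge> 2"
    and "k \<ge> max 2 ((CARD('n) - 1) * (CARD('n) - 2))"
    and "compact S"
    and "starlike S"
  shows "measure lebesgue (sumset_average S (k + 1)) \<ge> measure lebesgue (sumset_average S k) \<and>
    (measure lebesgue (sumset_average S (k + 1)) = measure lebesgue (sumset_average S k)
      \<longleftrightarrow> aff_dim S < int CARD('n) \<or> sumset_average S k = convex hull S)"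
proof -
  obtain p where p: "p \<in> S" "\<And>x. x \<in> S \<Longrightarrow> closed_segment p x \<subseteq> S"
    using assms(4) by (auto simp: starlike_def)
  \<comment> \<open>The centre of the star moves to the origin; volumes of averages, the hull
    condition and the affine dimension are unaffected.\<close>
  define T where "T = (+) (- p) ` S"
  have ST: "S = (+) p ` T" by (simp add: T_def image_image)
  have "compact T" unfolding T_def using assms(3) by (rule compact_translation)
  moreover have "0 \<in> T" using p(1) by (force simp: T_def)
  moreover have "t *\<^sub>R x \<in> T" if x: "x \<in> T" and t: "0 \<le> t" "t \<le> 1" for x t
  proof -
    have "p + x \<in> S" using x ST by blast
    moreover have "p + t *\<^sub>R x \<in> closed_segment p (p + x)"
      using t by (auto simp: in_segment algebra_simps intro!: exI[of _ t])
    ultimately have "p + t *\<^sub>R x \<in> S" using p(2) by blast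
    then show ?thesis by (force simp: T_def)
  qed
  ultimately have "measure lebesgue (sumset_average T k) \<le> measure lebesgue (sumset_average T (k + 1)) \<and>
    (measure lebesgue (sumset_average T (k + 1)) = measure lebesgue (sumset_average T k)
      \<longleftrightarrow> aff_dim T < int CARD('n) \<or> sumset_average T k = convex hull T)"
    using measure_sumset_average_mono_origin[of k T] assms(1,2) by simp
  moreover have "sumset_average S m = (+) p ` sumset_average T m" if "0 < m" for m
    unfolding ST using that by (rule sumset_average_translation)
  moreover have "convex hull S = (+) p ` (convex hull T)"
    unfolding ST by (rule convex_hull_translation)
  moreover have "aff_dim S = aff_dim T"
    unfolding ST by (rule aff_dim_translation_eq)
  moreover have "0 < k" using assms(2) by simp
  ultimately show ?thesis
    by (simp add: measure_translation inj_image_eq_iff)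
qed

end
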